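(* Let $K$ be a field of characteristic $p$ with $p=0$ or $p>3$. Then any $3$-Lie-Poisson algebra $(U,\cdot,\omega)$ over $K$ is strong; that is, for all $u_1,u_2,v_1,v_2,v_3,v_4\in U$, $$\sum_{i=1}^{4}(-1)^i\,\omega(u_1,u_2,v_i)\cdot\omega(v_1,\ldots,\widehat{v_i},\ldots,v_4)=0 .$$
   Context: A $3$-Lie-Poisson algebra over $K$ is a $K$-vector space $U$ with a bilinear multiplication $\cdot$ and a skew-symmetric trilinear map $\omega:U^3\to U$ such that: $(U,\cdot)$ is associative and commutative; the $3$-Lie identity holds, $$\omega(u_1,u_2,\omega(u_3,u_4,u_5))=\omega(\omega(u_1,u_2,u_3),u_4,u_5)+\omega(u_3,\omega(u_1,u_2,u_4),u_5)+\omega(u_3,u_4,\omega(u_1,u_2,u_5));$$ and the Leibniz identity holds, $\omega(u\cdot u',u_2,u_3)=u\cdot\omega(u',u_2,u_3)+u'\cdot\omega(u,u_2,u_3)$. A hat means omission. *)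

theory Defs
  imports Complex_Main
begin

text \<open>
  The underlying vector space is the whole type \<open>'u\<close>, with scalar multiplication \<open>scale\<close> over
  the field \<open>'k\<close>. The commutative associative product \<open>mul\<close> is not required to have a unit.
\<close>

locale three_Lie_Poisson_algebra = vector_space scale
  for scale :: "'k :: field \<Rightarrow> 'u :: ab_group_add \<Rightarrow> 'u" (infixr \<open>*s\<close> 75) +
  fixes mul :: "'u \<Rightarrow> 'u \<Rightarrow> 'u" (infixl \<open>\<bullet>\<close> 70)
    and \<omega> :: "'u \<Rightarrow> 'u \<Rightarrow> 'u \<Rightarrow> 'u"
  assumes mult_linear_left: "Vector_Spaces.linear scale scale (\<lambda>u. u \<bullet> v)"
    and mult_linear_right: "Vector_Spaces.linear scale scale (\<lambda>v. u \<bullet> v)"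
    and mult_assoc: "(u \<bullet> v) \<bullet> w = u \<bullet> (v \<bullet> w)"
    and mult_commute: "u \<bullet> v = v \<bullet> u"
    and omega_linear_1: "Vector_Spaces.linear scale scale (\<lambda>u. \<omega> u v w)"
    and omega_linear_2: "Vector_Spaces.linear scale scale (\<lambda>v. \<omega> u v w)"
    and omega_linear_3: "Vector_Spaces.linear scale scale (\<lambda>w. \<omega> u v w)"
    \<comment> \<open>the two adjacent transpositions generate the symmetric group on the three arguments\<close>
    and omega_skew_12: "\<omega> v u w = - \<omega> u v w"
    and omega_skew_23: "\<omega> u w v = - \<omega> u v w"
    and three_Lie_identity:
      "\<omega> u1 u2 (\<omega> u3 u4 u5) =
         \<omega> (\<omega> u1 u2 u3) u4 u5 + \<omega> u3 (\<omega> u1 u2 u4) u5 + \<omega> u3 u4 (\<omega> u1 u2 u5)"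
    and Leibniz_identity: "\<omega> (u \<bullet> u') u2 u3 = u \<bullet> \<omega> u' u2 u3 + u' \<bullet> \<omega> u u2 u3"

definition strong_three_Lie_Poisson_algebra ::
    "('k :: field \<Rightarrow> 'u :: ab_group_add \<Rightarrow> 'u) \<Rightarrow> ('u \<Rightarrow> 'u \<Rightarrow> 'u) \<Rightarrow> ('u \<Rightarrow> 'u \<Rightarrow> 'u \<Rightarrow> 'u) \<Rightarrow> bool"
  where
  "strong_three_Lie_Poisson_algebra scale mul \<omega> \<longleftrightarrow>
     three_Lie_Poisson_algebra scale mul \<omega> \<and>
     (\<forall>u1 u2 v1 v2 v3 v4.
        - mul (\<omega> u1 u2 v1) (\<omega> v2 v3 v4) + mul (\<omega> u1 u2 v2) (\<omega> v1 v3 v4)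
        - mul (\<omega> u1 u2 v3) (\<omega> v1 v2 v4) + mul (\<omega> u1 u2 v4) (\<omega> v1 v2 v3) = 0)"

end

theory Submission
  imports Defs
begin

text \<open>
  Applying the 3-Lie identity to the Hamiltonian derivation of a product \<open>x \<bullet> y\<close> and cancelling the
  terms already accounted for by \<open>x\<close> and \<open>y\<close> leaves quadratic relations
  \<open>\<Sum>\<plusminus>(\<omega>(y,u,a) \<bullet> \<omega>(x,b,c) + \<omega>(x,u,a) \<bullet> \<omega>(y,b,c)) = 0\<close>. A combination of four
  instances of them, with coefficients \<open>\<plusminus>1\<close>, is three times the strongness relation.
\<close>

context three_Lie_Poisson_algebra
begin

lemma mult_add_right: "c \<bullet> (a + b) = c \<bullet> a + c \<bullet> b"
  using module_hom.add[OF module_hom_linearI[OF mult_linear_right]] .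

lemma mult_minus_left: "(- a) \<bullet> c = - (a \<bullet> c)"
  using module_hom.neg[OF module_hom_linearI[OF mult_linear_left]] .

lemma mult_minus_right: "c \<bullet> (- a) = - (c \<bullet> a)"
  using module_hom.neg[OF module_hom_linearI[OF mult_linear_right]] .

lemma omega_add_1: "\<omega> (a + b) v w = \<omega> a v w + \<omega> b v w"
  using module_hom.add[OF module_hom_linearI[OF omega_linear_1]] .

lemma omega_add_2: "\<omega> u (a + b) w = \<omega> u a w + \<omega> u b w"
  using module_hom.add[OF module_hom_linearI[OF omega_linear_2]] .

lemma omega_add_3: "\<omega> u v (a + b) = \<omega> u v a + \<omega> u v b"
  using module_hom.add[OF module_hom_linearI[OF omega_linear_3]] .

lemma omega_rotate: "\<omega> v w u = \<omega> u v w"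
  using omega_skew_12[of u v w] omega_skew_23[of v u w] by simp

lemma Leibniz_identity_2: "\<omega> v (x \<bullet> y) w = x \<bullet> \<omega> v y w + y \<bullet> \<omega> v x w"
  using Leibniz_identity[of x y w v] by (simp only: omega_rotate[of _ w v])

lemma Leibniz_identity_3: "\<omega> v w (x \<bullet> y) = x \<bullet> \<omega> v w y + y \<bullet> \<omega> v w x"
  using Leibniz_identity[of x y v w] by (simp only: omega_rotate[of v w])

text \<open>The surviving terms are those in which the outer bracket differentiates the factor
  \<open>x\<close> or \<open>y\<close> that the Leibniz rule pulled out of an inner bracket.\<close>

lemma quadratic_relation:
  "\<omega> y u a \<bullet> \<omega> x b c - \<omega> y u b \<bullet> \<omega> x a c + \<omega> y u c \<bullet> \<omega> x a b
   + (\<omega> x u a \<bullet> \<omega> y b c - \<omega> x u b \<bullet> \<omega> y a c + \<omega> x u c \<bullet> \<omega> y a b) = 0"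
proof -
  have "x \<bullet> \<omega> y u (\<omega> a b c) + y \<bullet> \<omega> x u (\<omega> a b c) = \<omega> (x \<bullet> y) u (\<omega> a b c)"
    by (simp only: Leibniz_identity)
  also have "\<dots> = \<omega> (\<omega> (x \<bullet> y) u a) b c + \<omega> a (\<omega> (x \<bullet> y) u b) c + \<omega> a b (\<omega> (x \<bullet> y) u c)"
    by (rule three_Lie_identity)
  finally show ?thesis
    \<comment> \<open>Fixing \<open>a b c\<close> expands only the brackets around
      \<open>\<omega> a b c\<close>; the general rule would rewrite its own last summand
      forever.\<close>
    unfolding three_Lie_identity[of _ _ a b c] Leibniz_identity[of x y u]
    by (simp add: Leibniz_identity Leibniz_identity_2 Leibniz_identity_3 omega_add_1 omega_add_2
        omega_add_3 mult_add_right omega_skew_12[of a x] omega_skew_12[of a y]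
        omega_rotate[of a b] mult_minus_right algebra_simps)
qed

lemma three_times_strong_relation:
  fixes u1 u2 v1 v2 v3 v4 :: 'u
  defines "t \<equiv> - (\<omega> u1 u2 v1 \<bullet> \<omega> v2 v3 v4) + \<omega> u1 u2 v2 \<bullet> \<omega> v1 v3 v4
    - \<omega> u1 u2 v3 \<bullet> \<omega> v1 v2 v4 + \<omega> u1 u2 v4 \<bullet> \<omega> v1 v2 v3"
  shows "t + t + t = 0"
proof -
  let ?R = "\<lambda>y u a x b c.
    \<omega> y u a \<bullet> \<omega> x b c - \<omega> y u b \<bullet> \<omega> x a c + \<omega> y u c \<bullet> \<omega> x a b
    + (\<omega> x u a \<bullet> \<omega> y b c - \<omega> x u b \<bullet> \<omega> y a c + \<omega> x u c \<bullet> \<omega> y a b)"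
  \<comment> \<open>Transpositions directed towards the order \<open>u1, u2, v1, ..., v4\<close>;
    undirected skew symmetry would loop.\<close>
  have sort: "\<omega> v2 v1 w = - \<omega> v1 v2 w" "\<omega> v3 v1 w = - \<omega> v1 v3 w" "\<omega> v4 v1 w = - \<omega> v1 v4 w"
    "\<omega> v3 v2 w = - \<omega> v2 v3 w" "\<omega> v4 v2 w = - \<omega> v2 v4 w"
    "\<omega> u2 u1 w = - \<omega> u1 u2 w"
    "\<omega> v1 u2 w = - \<omega> u2 v1 w" "\<omega> v2 u2 w = - \<omega> u2 v2 w"
    "\<omega> v3 u1 w = - \<omega> u1 v3 w" "\<omega> v4 u1 w = - \<omega> u1 v4 w"
    "\<omega> w v2 v1 = - \<omega> w v1 v2" "\<omega> w v3 v1 = - \<omega> w v1 v3" "\<omega> w v4 v1 = - \<omega> w v1 v4"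
    "\<omega> w v3 v2 = - \<omega> w v2 v3" "\<omega> w v4 v2 = - \<omega> w v2 v4" "\<omega> w v4 v3 = - \<omega> w v3 v4" for w
    by (rule omega_skew_12 omega_skew_23)+
  \<comment> \<open>The i-th instance has \<open>y = vi\<close> and contains every term of
    \<open>t\<close>, up to sign, except the one with \<open>\<omega> u1 u2 vi\<close>. So each term
    occurs three times, while the products of a bracket containing \<open>u1\<close> but not
    \<open>u2\<close> with one containing \<open>u2\<close> but not \<open>u1\<close>
    cancel.\<close>
  have "t + t + t = ?R v1 u2 v2 u1 v3 v4 - ?R v2 u2 v1 u1 v3 v4 - ?R v3 u1 v1 u2 v2 v4
      + ?R v4 u1 v1 u2 v2 v3"
    unfolding t_def
    by (simp add: sort mult_minus_left mult_minus_right mult_commute algebra_simps)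
  then show ?thesis
    by (simp add: quadratic_relation)
qed

end

theorem theorem4p1:
  fixes scale :: "'k :: field \<Rightarrow> 'u :: ab_group_add \<Rightarrow> 'u"
    and mul :: "'u \<Rightarrow> 'u \<Rightarrow> 'u"
    and \<omega> :: "'u \<Rightarrow> 'u \<Rightarrow> 'u \<Rightarrow> 'u"
  assumes "CHAR('k) = 0 \<or> CHAR('k) > 3"
    and "three_Lie_Poisson_algebra scale mul \<omega>"
  shows "strong_three_Lie_Poisson_algebra scale mul \<omega>"
proof -
  interpret three_Lie_Poisson_algebra scale mul \<omega> by fact
  \<comment> \<open>The characteristic enters here, to cancel the factor 3: zero does not divide 3,
    nor does a number above 3.\<close>
  have "\<not> CHAR('k) dvd 3"
    using assms(1) by (auto dest: dvd_imp_le)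
  then have "(3 :: 'k) \<noteq> 0"
    using of_nat_eq_0_iff_char_dvd[where 'a = 'k, of 3] by simp
  moreover have "scale 3 t = t + t + t" for t
    using scale_left_distrib[of 2 1 t] scale_left_distrib[of 1 1 t] by simp
  ultimately have "t = 0" if "t + t + t = 0" for t :: 'u
    using that scale_eq_0_iff[of 3 t] by simp
  then show ?thesis
    unfolding strong_three_Lie_Poisson_algebra_def
    using assms(2) three_times_strong_relation by blast
qed

end
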